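(* Let $q$ be an odd prime power, let $C=\langle R\rangle\le \mathrm{PGL}_2(q)$ be a Singer group with generator $R$, let $P_0\in\mathbb P^1(\mathbb F_q)$, and let $J=R^{(q+1)/2}$. If $M\in\mathrm{PGL}_2(q)$ satisfies $MJ\neq JM$, then the permutation $F_M$ of $\mathbb Z_{q+1}$ is APN. Moreover, its compositional inverse is obtained by the same construction: $F_M^{-1}=F_N$ (with the same $R$ and $P_0$) for some $N\in\mathrm{PGL}_2(q)$ with $NJ\neq JN$.
   Context: $\mathbb Z_n=\mathbb Z/n\mathbb Z$. The differential uniformity of $F:\mathbb Z_n\to\mathbb Z_n$ is $\delta(F)=\max_{u\neq 0,\,v\in\mathbb Z_n}\#\{x\in\mathbb Z_n: F(x+u)-F(x)=v\}$, and $F$ is called APN if $\delta(F)=2$. $\mathrm{PGL}_2(q)=\mathrm{GL}_2(q)/\{\lambda I:\lambda\in\mathbb F_q^*\}$ acts on the projective line $\mathbb P^1(\mathbb F_q)$ (the set of one-dimensional subspaces of $\mathbb F_q^2$, of size $q+1$). A Singer group is a cyclic subgroup $C\le\mathrm{PGL}_2(q)$ of order $q+1$; it acts regularly on $\mathbb P^1(\mathbb F_q)$. Let $q$ be an odd prime power and $n=q+1$. Fix a generator $R$ of $C$ and a base point $P_0\in\mathbb P^1(\mathbb F_q)$. The map $\exp_{R,P_0}:\mathbb Z_n\to\mathbb P^1(\mathbb F_q)$, $i\mapsto R^iP_0$, is a bijection, with inverse denoted $\log_{R,P_0}$. $J=R^{n/2}$ is the unique element of order two in $C$. For $M\in\mathrm{PGL}_2(q)$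 define the permutation $F_M=\log_{R,P_0}\circ M\circ\exp_{R,P_0}$ of $\mathbb Z_n$; that is, $F_M(i)=j$ iff $M(R^iP_0)=R^jP_0$. *)

theory Defs
  imports
    "HOL-Analysis.Determinants"
    "HOL-Algebra.Elementary_Groups"
    "HOL-Number_Theory.Residues"
begin

abbreviation Z_mod :: "nat \<Rightarrow> int ring" where
  "Z_mod n \<equiv> residue_ring (int n)"

text \<open>Functions on \<open>\<int>/n\<int>\<close> are functions on \<^typ>\<open>int\<close> whose values outside the
  carrier \<open>{0..int n - 1}\<close> are irrelevant.\<close>

definition differential_uniformity :: "nat \<Rightarrow> (int \<Rightarrow> int) \<Rightarrow> nat" where
  "differential_uniformity n F =
     Max {card {x \<in> carrier (Z_mod n).
                  F (x \<oplus>\<^bsub>Z_mod n\<^esub> u) \<ominus>\<^bsub>Z_mod n\<^esub> F x = v} | u v.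
          u \<in> carrier (Z_mod n) - {\<zero>\<^bsub>Z_mod n\<^esub>} \<and> v \<in> carrier (Z_mod n)}"

definition APN :: "nat \<Rightarrow> (int \<Rightarrow> int) \<Rightarrow> bool" where
  "APN n F \<longleftrightarrow> differential_uniformity n F = 2"

definition GL2 :: "('a::field ^ 2 ^ 2) monoid" where
  "GL2 = \<lparr>carrier = {A. invertible A}, monoid.mult = (**), one = mat 1\<rparr>"

definition scalar_matrices :: "('a::field ^ 2 ^ 2) set" where
  "scalar_matrices = {mat c | c. c \<noteq> 0}"

text \<open>Elements of \<open>PGL2\<close> are cosets, i.e. sets of pairwise proportional matrices.\<close>

definition PGL2 :: "('a::field ^ 2 ^ 2) set monoid" where
  "PGL2 = GL2 Mod scalar_matrices"

definition proj_line :: "('a::field ^ 2) set set" where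
  "proj_line = {L. vec.subspace L \<and> vec.dim L = 1}"

text \<open>All matrices in a coset \<open>M\<close> map a subspace \<open>L\<close> to the same subspace,
  so the union below is just this common image.\<close>

definition PGL2_act :: "('a::field ^ 2 ^ 2) set \<Rightarrow> ('a ^ 2) set \<Rightarrow> ('a ^ 2) set" where
  "PGL2_act M L = (\<Union>A\<in>M. (\<lambda>x. A *v x) ` L)"

definition singer_group :: "('a::{field,finite} ^ 2 ^ 2) set set \<Rightarrow> bool" where
  "singer_group C \<longleftrightarrow>
     subgroup C PGL2 \<and> cyclic_group (PGL2\<lparr>carrier := C\<rparr>) \<and>
     order (PGL2\<lparr>carrier := C\<rparr>) = CARD('a) + 1"

definition singer_exp ::
  "('a::{field,finite} ^ 2 ^ 2) set \<Rightarrow> ('a ^ 2) set \<Rightarrow> int \<Rightarrow> ('a ^ 2) set" where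
  "singer_exp R P0 i = PGL2_act (R [^]\<^bsub>PGL2\<^esub> i) P0"

definition singer_log ::
  "('a::{field,finite} ^ 2 ^ 2) set \<Rightarrow> ('a ^ 2) set \<Rightarrow> ('a ^ 2) set \<Rightarrow> int" where
  "singer_log R P0 = inv_into (carrier (Z_mod (CARD('a) + 1))) (singer_exp R P0)"

definition singer_perm ::
  "('a::{field,finite} ^ 2 ^ 2) set \<Rightarrow> ('a ^ 2) set \<Rightarrow> ('a ^ 2 ^ 2) set \<Rightarrow> int \<Rightarrow> int" where
  "singer_perm R P0 M = singer_log R P0 \<circ> PGL2_act M \<circ> singer_exp R P0"

end

theory Submission
  imports Defs
begin

text \<open>
  Write \<open>q\<close> for the size of the field, \<open>n = q + 1\<close>, and identify residues modulo \<open>n\<close> with points of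
  the projective line through \<open>x \<mapsto> R\<^sup>x P0\<close>. Under this identification adding \<open>u\<close> becomes the action
  of \<open>R\<^sup>u\<close> and \<open>F\<close> becomes the action of \<open>M\<close>, so that the equation \<open>F (x + u) - F x = v\<close> says that
  \<open>M R\<^sup>u\<close> and \<open>R\<^sup>v M\<close> agree at the point \<open>R\<^sup>x P0\<close>. Two different elements of \<open>PGL2\<close> agree
  in at most two points (\<open>PGL2_agree_le_two\<close>), since a nonscalar matrix of size two has at most two
  eigenlines. Hence every equation with nonzero \<open>u\<close> has at most two solutions, unless
  \<open>M R\<^sup>u = R\<^sup>v M\<close>.

  In the exceptional case \<open>M\<close> conjugates a nontrivial element of the Singer group \<open>C\<close> into \<open>C\<close>. Up to
  scalars, \<open>C\<close> consists of the nonzero elements of the algebra of all \<open>a + b A\<close>, where \<open>A\<close> is a matrix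
  representing \<open>R\<close>, and this algebra is generated by each of its nonscalar elements. Therefore \<open>M\<close>
  normalizes \<open>C\<close> (\<open>intertwiner_normalizes\<close>) and commutes with its unique involution \<open>J\<close>
  (\<open>normalizer_commutes_involution\<close>), contrary to the hypothesis. That the value \<open>2\<close> is attained
  is a pigeonhole argument valid for all permutations (\<open>APN_Z_modI\<close>), and the inverse of \<open>F\<close> comes
  from the inverse of \<open>M\<close>, which commutes with \<open>J\<close> only if \<open>M\<close> does.

  The structure of \<open>C\<close> and its regular action on the projective line rest on one counting argument,
  \<open>pencil_is_power\<close>: the \<open>q + 1\<close> powers of \<open>R\<close> have to fill all the at most \<open>q + 1\<close> lines of the
  algebra, which makes every nonzero element of it invertible.
\<close>

section \<open>Almost perfect nonlinear permutations\<close>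

text \<open>For a permutation only the upper bound on the fibres of the derivatives has to be checked:
  the derivative of a permutation in a nonzero direction never takes the value \<open>0\<close>, so by the
  pigeonhole principle it is not injective.\<close>

lemma APN_Z_modI:
  fixes F :: "int \<Rightarrow> int"
  assumes n: "n > 1"
    and F: "bij_betw F {0..int n - 1} {0..int n - 1}"
    and le: "\<And>u v. u \<in> {1..int n - 1} \<Longrightarrow> v \<in> {0..int n - 1} \<Longrightarrow>
               card {x \<in> {0..int n - 1}. (F ((x + u) mod int n) - F x) mod int n = v} \<le> 2"
  shows "APN n F"
proof -
  let ?Z = "{0..int n - 1}"
  let ?S = "\<lambda>u v. {x \<in> ?Z. (F ((x + u) mod int n) - F x) mod int n = v}"
  interpret residues "int n" "Z_mod n" by unfold_locales (use n in simp_all)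
  have FZ: "F x \<in> ?Z" if "x \<in> ?Z" for x using F that by (rule bij_betw_apply)
  have S_eq: "{x \<in> carrier (Z_mod n). F (x \<oplus>\<^bsub>Z_mod n\<^esub> u) \<ominus>\<^bsub>Z_mod n\<^esub> F x = v} = ?S u v" for u v
    by (auto simp: res_carrier_eq res_add_eq a_minus_def res_neg_eq mod_simps)
  have "differential_uniformity n F = Max {card (?S u v) | u v. u \<in> ?Z - {0} \<and> v \<in> ?Z}"
    unfolding differential_uniformity_def S_eq by (simp add: res_carrier_eq res_zero_eq)
  also have "\<dots> = 2"
  proof (rule Max_eqI)
    show "finite {card (?S u v) | u v. u \<in> ?Z - {0} \<and> v \<in> ?Z}"
      by (rule finite_image_set2) (simp_all only: Collect_mem_eq finite_Diff finite_atLeastAtMost_int)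
    show "y \<le> 2" if "y \<in> {card (?S u v) | u v. u \<in> ?Z - {0} \<and> v \<in> ?Z}" for y
    proof -
      from that obtain u v where uv: "y = card (?S u v)" "u \<in> ?Z - {0}" "v \<in> ?Z" by blast
      then have "u \<in> {1..int n - 1}" by auto
      then show ?thesis unfolding uv(1) by (rule le) (rule uv(3))
    qed
    \<comment> \<open>The derivative in direction \<open>1\<close> maps \<open>n\<close> points into the \<open>n - 1\<close> nonzero residues,
      because \<open>F\<close> is injective; so it takes some value twice.\<close>
    let ?d = "\<lambda>x. (F ((x + 1) mod int n) - F x) mod int n"
    have nonzero: "?d x \<noteq> 0" if x: "x \<in> ?Z" for x
    proof
      assume "?d x = 0"
      then have "F ((x + 1) mod int n) mod int n = F x mod int n"
        by (simp add: mod_eq_dvd_iff mod_eq_0_iff_dvd)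
      moreover have x1: "(x + 1) mod int n \<in> ?Z" using n by simp
      ultimately have "F ((x + 1) mod int n) = F x"
        using FZ[OF x] FZ[OF x1] by simp
      then have "(x + 1) mod int n = x"
        using F x x1 by (auto simp: bij_betw_def inj_on_def)
      then have "(x + 1) mod int n = x mod int n" using x by simp
      then have "int n dvd 1" by (simp add: mod_eq_dvd_iff)
      with n show False by simp
    qed
    have "?d ` ?Z \<subseteq> ?Z - {0}"
    proof (rule image_subsetI)
      fix x assume x: "x \<in> ?Z"
      have "?d x \<in> ?Z" using n by simp
      with nonzero[OF x] show "?d x \<in> ?Z - {0}" by blast
    qed
    then have "card (?d ` ?Z) \<le> card (?Z - {0})" by (rule card_mono[rotated]) simp
    also have "\<dots> < card ?Z" using n by simp
    finally obtain x y where xy: "x \<in> ?Z" "y \<in> ?Z" "x \<noteq> y" "?d x = ?d y"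
      using pigeonhole[of ?d ?Z] unfolding inj_on_def by blast
    have "card {x, y} \<le> card (?S 1 (?d x))"
      by (intro card_mono finite_subset[of "?S 1 (?d x)" ?Z]) (use xy in auto)
    with xy have "2 \<le> card (?S 1 (?d x))" by simp
    moreover have "?d x \<in> ?Z" using n by simp
    ultimately have "card (?S 1 (?d x)) = 2"
      using le[of 1 "?d x"] n by force
    then show "2 \<in> {card (?S u v) | u v. u \<in> ?Z - {0} \<and> v \<in> ?Z}"
      using n \<open>?d x \<in> ?Z\<close> by force
  qed
  finally show ?thesis by (simp add: APN_def)
qed

section \<open>Points of the projective line\<close>

definition line :: "'a::field ^ 2 \<Rightarrow> ('a ^ 2) set" where
  "line v = vec.span {v}"

lemma line_altdef: "line v = range (\<lambda>c. c *s v)"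
  by (simp add: line_def vec.span_singleton)

lemma line_in_proj_line: "v \<noteq> 0 \<Longrightarrow> line v \<in> proj_line"
  by (simp add: line_def proj_line_def vec.subspace_span vec.dim_span)

lemma proj_lineE:
  assumes "L \<in> proj_line"
  obtains v where "v \<noteq> 0" "L = line v"
proof -
  obtain B where B: "B \<subseteq> L" "vec.independent B" "L \<subseteq> vec.span B" "card B = vec.dim L"
    using vec.basis_exists[of L] by blast
  with assms obtain v where v: "B = {v}"
    by (auto simp: proj_line_def card_1_singleton_iff)
  have "v \<noteq> 0" using B(2) v by (simp add: vec.dependent_single)
  moreover have "L = line v"
    using B v assms vec.span_minimal[of B L] by (auto simp: line_def proj_line_def)
  ultimately show ?thesis by (rule that)
qed

lemma line_eq_iff:
  assumes "v \<noteq> 0" "w \<noteq> 0"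
  shows "line v = line w \<longleftrightarrow> (\<exists>c. c \<noteq> 0 \<and> v = c *s w)"
proof
  assume "line v = line w"
  then have "v \<in> line w" by (metis line_def singletonI vec.span_base)
  then obtain c where "v = c *s w" by (auto simp: line_altdef)
  with assms show "\<exists>c. c \<noteq> 0 \<and> v = c *s w" by (metis vec.scale_zero_left)
next
  assume "\<exists>c. c \<noteq> 0 \<and> v = c *s w"
  then obtain c where c: "c \<noteq> 0" "v = c *s w" by blast
  have "b *s w = (b / c) *s v" for b using c by (simp add: vec.scale_scale)
  moreover have "b *s v = (b * c) *s w" for b using c by (simp add: vec.scale_scale)
  ultimately show "line v = line w" unfolding line_altdef by blast
qed

text \<open>The affine points \<open>(1 : a)\<close> together with the point at infinity \<open>(0 : 1)\<close>. Indexing them by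
  \<^typ>\<open>'a option\<close> makes the upper bound \<open>q + 1\<close> for the number of points a cardinality of a
  type.\<close>

lemma proj_line_subset_range:
  "(proj_line :: ('a::field ^ 2) set set)
     \<subseteq> range (\<lambda>a. line (case a of None \<Rightarrow> vector [0, 1] | Some a \<Rightarrow> vector [1, a]))"
  (is "_ \<subseteq> range ?f")
proof
  fix L :: "('a ^ 2) set" assume "L \<in> proj_line"
  then obtain v where v: "v \<noteq> 0" "L = line v" by (rule proj_lineE)
  show "L \<in> range ?f"
  proof (cases "v $ 1 = 0")
    case True
    have "L = ?f None"
      unfolding v using True v(1)
      by (subst line_eq_iff) (auto simp: vec_eq_iff forall_2)
    then show ?thesis by blast
  next
    case False
    have "L = ?f (Some (v $ 2 / v $ 1))"
      unfolding v using False v(1)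
      by (subst line_eq_iff) (auto simp: vec_eq_iff forall_2)
    then show ?thesis by blast
  qed
qed

lemma finite_proj_line: "finite (proj_line :: ('a::{field,finite} ^ 2) set set)"
  by (rule finite_subset[OF proj_line_subset_range]) simp

lemma card_proj_line_le: "card (proj_line :: ('a::{field,finite} ^ 2) set set) \<le> CARD('a) + 1"
proof -
  let ?f = "\<lambda>a. line (case a of None \<Rightarrow> vector [0, 1] | Some a \<Rightarrow> vector [1, a]) :: ('a ^ 2) set"
  have "card (proj_line :: ('a ^ 2) set set) \<le> card (range ?f)"
    by (rule card_mono[OF _ proj_line_subset_range]) simp
  also have "\<dots> \<le> CARD('a option)" by (rule card_image_le) simp
  finally show ?thesis by simp
qed

lemma line_combination:
  fixes v w :: "'a::field ^ 2"
  assumes "v \<noteq> 0" "w \<noteq> 0" "line v \<noteq> line w"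
  obtains a b where "x = a *s v + b *s w"
proof -
  \<comment> \<open>Cramer's rule: \<open>D\<close> is the determinant of the matrix with columns \<open>v\<close> and \<open>w\<close>.\<close>
  define D where "D = v $ 1 * w $ 2 - v $ 2 * w $ 1"
  have "D \<noteq> 0"
  proof
    assume D: "D = 0"
    have "\<exists>c. c \<noteq> 0 \<and> v = c *s w"
    proof (cases "w $ 1 = 0")
      case True
      with D assms have "w $ 2 \<noteq> 0" "v $ 1 = 0" "v $ 2 \<noteq> 0"
        by (auto simp: D_def vec_eq_iff forall_2)
      then show ?thesis using True
        by (intro exI[of _ "v $ 2 / w $ 2"]) (auto simp: vec_eq_iff forall_2)
    next
      case False
      have "v $ 1 \<noteq> 0"
        using D assms(1) False by (auto simp: D_def vec_eq_iff forall_2)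
      then show ?thesis using False D
        by (intro exI[of _ "v $ 1 / w $ 1"]) (auto simp: vec_eq_iff forall_2 D_def field_simps)
    qed
    with assms show False by (simp add: line_eq_iff)
  qed
  have "x = ((x $ 1 * w $ 2 - x $ 2 * w $ 1) / D) *s v + ((v $ 1 * x $ 2 - v $ 2 * x $ 1) / D) *s w"
    using \<open>D \<noteq> 0\<close> unfolding vec_eq_iff forall_2
    by (simp add: divide_simps) (simp add: D_def algebra_simps)
  then show ?thesis by (rule that)
qed

section \<open>The group of classes of matrices modulo scalars\<close>

definition pgl_class :: "'a::field ^ 2 ^ 2 \<Rightarrow> ('a ^ 2 ^ 2) set" where
  "pgl_class A = scalar_matrices #>\<^bsub>GL2\<^esub> A"

lemma pgl_class_altdef: "pgl_class A = {mat c ** A | c. c \<noteq> 0}"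
  by (auto simp: pgl_class_def r_coset_def GL2_def scalar_matrices_def)

lemma mat_mult_vec:
  fixes A :: "'a::field ^ 2 ^ 2"
  shows "(mat c ** A) *v x = c *s (A *v x)"
  by (simp add: vec_eq_iff forall_2 matrix_vector_mult_def matrix_matrix_mult_def mat_def sum_2
      algebra_simps)

lemma mat_vec: "mat c *v x = c *s (x :: 'a::field ^ 2)"
  using mat_mult_vec[of c "mat 1" x] by simp

lemma mat_mult_mat: "mat c ** mat d = (mat (c * d) :: 'a::field ^ 2 ^ 2)"
  by (simp add: vec_eq_iff forall_2 matrix_matrix_mult_def mat_def sum_2)

lemma mat_commute: "A ** mat c = mat c ** (A :: 'a::field ^ 2 ^ 2)"
  by (simp add: vec_eq_iff forall_2 matrix_matrix_mult_def mat_def sum_2 mult.commute)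

lemma matrix_add_rdistrib: "(A + B) ** C = A ** C + B ** (C :: 'a::field ^ 2 ^ 2)"
  by (simp add: vec_eq_iff forall_2 matrix_matrix_mult_def sum_2 algebra_simps)

lemma invertible_mat: "c \<noteq> 0 \<Longrightarrow> invertible (mat c :: 'a::field ^ 2 ^ 2)"
  unfolding invertible_def by (rule exI[of _ "mat (inverse c)"]) (simp add: mat_mult_mat)

lemma group_GL2: "group (GL2 :: ('a::field ^ 2 ^ 2) monoid)"
proof (rule groupI)
  fix A :: "'a ^ 2 ^ 2" assume "A \<in> carrier GL2"
  then show "\<exists>B\<in>carrier GL2. B \<otimes>\<^bsub>GL2\<^esub> A = \<one>\<^bsub>GL2\<^esub>"
    by (auto simp: GL2_def invertible_def)
qed (simp_all add: GL2_def invertible_mult matrix_mul_assoc invertible_mat)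

lemma normal_scalar_matrices: "(scalar_matrices :: ('a::field ^ 2 ^ 2) set) \<lhd> GL2"
proof -
  interpret group "GL2 :: ('a ^ 2 ^ 2) monoid" by (rule group_GL2)
  have "subgroup (scalar_matrices :: ('a ^ 2 ^ 2) set) GL2"
  proof (rule subgroupI)
    show "(scalar_matrices :: ('a ^ 2 ^ 2) set) \<subseteq> carrier GL2"
      by (auto simp: scalar_matrices_def GL2_def invertible_mat)
    show "(scalar_matrices :: ('a ^ 2 ^ 2) set) \<noteq> {}"
      by (auto simp: scalar_matrices_def intro: exI[of _ 1])
    fix A :: "'a ^ 2 ^ 2" assume "A \<in> scalar_matrices"
    then obtain c where c: "A = mat c" "c \<noteq> 0" by (auto simp: scalar_matrices_def)
    have "inv\<^bsub>GL2\<^esub> A = mat (inverse c)"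
      by (rule inv_equality) (use c in \<open>auto simp: GL2_def mat_mult_mat invertible_mat\<close>)
    then show "inv\<^bsub>GL2\<^esub> A \<in> scalar_matrices" using c by (auto simp: scalar_matrices_def)
    fix B :: "'a ^ 2 ^ 2" assume "B \<in> scalar_matrices"
    then obtain d where "B = mat d" "d \<noteq> 0" by (auto simp: scalar_matrices_def)
    with c show "A \<otimes>\<^bsub>GL2\<^esub> B \<in> scalar_matrices"
      by (auto simp: scalar_matrices_def GL2_def mat_mult_mat intro!: exI[of _ "c * d"])
  qed
  then show ?thesis
    by (rule normalI)
       (auto simp: r_coset_def l_coset_def GL2_def scalar_matrices_def mat_commute)
qed

lemma group_PGL2: "group (PGL2 :: ('a::field ^ 2 ^ 2) set monoid)"
  unfolding PGL2_def by (rule normal.factorgroup_is_group[OF normal_scalar_matrices])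

lemma carrier_PGL2: "carrier PGL2 = pgl_class ` {A. invertible A}"
  by (auto simp: PGL2_def FactGroup_def RCOSETS_def pgl_class_def GL2_def)

lemma PGL2_E:
  assumes "X \<in> carrier PGL2"
  obtains A where "invertible A" "X = pgl_class A"
  using assms by (auto simp: carrier_PGL2)

lemma pgl_class_mult:
  assumes "invertible A" "invertible B"
  shows "pgl_class A \<otimes>\<^bsub>PGL2\<^esub> pgl_class B = pgl_class (A ** B)"
  using normal.rcos_sum[OF normal_scalar_matrices, of A B] assms
  by (simp add: pgl_class_def PGL2_def GL2_def)

lemma one_PGL2: "\<one>\<^bsub>PGL2\<^esub> = pgl_class (mat 1)"
  by (auto simp: PGL2_def FactGroup_def pgl_class_altdef scalar_matrices_def)

lemma pgl_class_eq_iff: "pgl_class A = pgl_class B \<longleftrightarrow> (\<exists>c. c \<noteq> 0 \<and> A = mat c ** B)"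
proof
  assume "pgl_class A = pgl_class B"
  moreover have "A \<in> pgl_class A"
    by (auto simp: pgl_class_altdef intro!: exI[of _ 1])
  ultimately show "\<exists>c. c \<noteq> 0 \<and> A = mat c ** B"
    by (auto simp: pgl_class_altdef)
next
  assume "\<exists>c. c \<noteq> 0 \<and> A = mat c ** B"
  then obtain c where c: "c \<noteq> 0" "A = mat c ** B" by blast
  have "mat d ** B = mat (d / c) ** A" for d
    using c by (simp add: matrix_mul_assoc mat_mult_mat)
  moreover have "mat d ** A = mat (d * c) ** B" for d
    using c by (simp add: matrix_mul_assoc mat_mult_mat)
  ultimately show "pgl_class A = pgl_class B"
    using c(1) unfolding pgl_class_altdef by (metis divide_eq_0_iff mult_eq_0_iff)
qed

lemma pgl_class_mat: "c \<noteq> 0 \<Longrightarrow> pgl_class (mat c) = \<one>\<^bsub>PGL2\<^esub>"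
  by (auto simp: one_PGL2 pgl_class_eq_iff mat_mult_mat intro!: exI[of _ c])

text \<open>By Cayley--Hamilton \<open>A\<^sup>2\<close> is a combination of \<open>1\<close> and \<open>A\<close>, so the pencil of all
  \<open>a + b A\<close> is closed under multiplication by \<open>A\<close> and contains every power of \<open>A\<close>.\<close>

lemma pgl_class_pow:
  fixes A :: "'a::field ^ 2 ^ 2" and k :: nat
  assumes "invertible A"
  shows "\<exists>B. invertible B \<and> pgl_class A [^]\<^bsub>PGL2\<^esub> k = pgl_class B \<and> (\<exists>a b. B = mat a + mat b ** A)"
proof (induction k)
  case 0
  have "mat 1 = mat 1 + mat 0 ** A"
    by (simp add: vec_eq_iff forall_2 mat_def matrix_matrix_mult_def sum_2)
  moreover have "pgl_class A [^]\<^bsub>PGL2\<^esub> (0::nat) = pgl_class (mat 1)"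
    by (simp add: one_PGL2)
  ultimately show ?case using invertible_mat[of "1::'a"] by (metis zero_neq_one)
next
  case (Suc k)
  then obtain B a b where B: "invertible B" "pgl_class A [^]\<^bsub>PGL2\<^esub> k = pgl_class B"
    "B = mat a + mat b ** A" by blast
  have "pgl_class A [^]\<^bsub>PGL2\<^esub> Suc k = pgl_class (B ** A)"
    using B assms by (simp add: group.is_monoid[OF group_PGL2] monoid.nat_pow_Suc pgl_class_mult)
  \<comment> \<open>Substitute \<open>A\<^sup>2 = tr(A) A - det(A)\<close> into \<open>a A + b A\<^sup>2\<close>.\<close>
  moreover have "B ** A = mat (- b * (A $ 1 $ 1 * A $ 2 $ 2 - A $ 1 $ 2 * A $ 2 $ 1))
      + mat (a + b * (A $ 1 $ 1 + A $ 2 $ 2)) ** A"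
    unfolding B(3)
    by (simp add: vec_eq_iff forall_2 matrix_matrix_mult_def mat_def sum_2 algebra_simps)
  ultimately show ?case using B(1) assms invertible_mult by blast
qed

section \<open>The action on the projective line\<close>

lemma PGL2_act_class:
  fixes A :: "'a::field ^ 2 ^ 2"
  shows "PGL2_act (pgl_class A) (line v) = line (A *v v)"
proof -
  have img: "(\<lambda>x. (mat c ** A) *v x) ` line v = line (A *v v)" if "c \<noteq> 0" for c
  proof -
    have "(\<lambda>x. (mat c ** A) *v x) ` line v = line (c *s (A *v v))"
      by (simp add: line_altdef image_image mat_mult_vec vector_scalar_commute mult.commute)
    also have "\<dots> = line (A *v v)"
    proof (cases "A *v v = 0")
      case False
      with that show ?thesis by (subst line_eq_iff) auto
    qed simp
    finally show ?thesis .
  qed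
  have "pgl_class A = (\<lambda>c. mat c ** A) ` (- {0})" by (auto simp: pgl_class_altdef)
  then have "PGL2_act (pgl_class A) (line v) = (\<Union>c\<in>- {0}. (\<lambda>x. (mat c ** A) *v x) ` line v)"
    by (simp only: PGL2_act_def image_image UN_simps)
  also have "\<dots> = (\<Union>c\<in>- {0 :: 'a}. line (A *v v))" using img by (intro SUP_cong) auto
  also have "\<dots> = line (A *v v)"
  proof -
    have "(1::'a) \<in> - {0}" by simp
    then have "- {0 :: 'a} \<noteq> {}" by (metis empty_iff)
    then show ?thesis by (simp only: UN_constant if_False)
  qed
  finally show ?thesis .
qed

lemma invertible_mult_eq_0:
  fixes A :: "'a::field ^ 2 ^ 2"
  assumes "invertible A" "A *v v = 0"
  shows "v = 0"
proof -
  obtain B where "B ** A = mat 1" using assms(1) by (auto simp: invertible_def)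
  then have "v = B *v (A *v v)" by (simp add: matrix_vector_mul_assoc)
  with assms(2) show ?thesis by simp
qed

lemma PGL2_act_closed:
  assumes "X \<in> carrier PGL2" "L \<in> proj_line"
  shows "PGL2_act X L \<in> proj_line"
proof -
  obtain A where A: "invertible A" "X = pgl_class A" using assms(1) by (rule PGL2_E)
  obtain v where v: "v \<noteq> 0" "L = line v" using assms(2) by (rule proj_lineE)
  have "A *v v \<noteq> 0" using invertible_mult_eq_0[OF A(1)] v(1) by blast
  then show ?thesis by (simp add: A(2) v(2) PGL2_act_class line_in_proj_line)
qed

lemma PGL2_act_mult:
  assumes "X \<in> carrier PGL2" "Y \<in> carrier PGL2" "L \<in> proj_line"
  shows "PGL2_act (X \<otimes>\<^bsub>PGL2\<^esub> Y) L = PGL2_act X (PGL2_act Y L)"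
proof -
  obtain A where "invertible A" "X = pgl_class A" using assms(1) by (rule PGL2_E)
  moreover obtain B where "invertible B" "Y = pgl_class B" using assms(2) by (rule PGL2_E)
  moreover obtain v where "L = line v" using assms(3) by (rule proj_lineE)
  ultimately show ?thesis by (simp add: pgl_class_mult PGL2_act_class matrix_vector_mul_assoc)
qed

lemma PGL2_act_one: "L \<in> proj_line \<Longrightarrow> PGL2_act \<one>\<^bsub>PGL2\<^esub> L = L"
  by (erule proj_lineE) (simp add: one_PGL2 PGL2_act_class)

lemma PGL2_act_inv:
  assumes "X \<in> carrier PGL2" "L \<in> proj_line"
  shows "PGL2_act (inv\<^bsub>PGL2\<^esub> X) (PGL2_act X L) = L"
proof -
  have "inv\<^bsub>PGL2\<^esub> X \<in> carrier PGL2" by (rule group.inv_closed[OF group_PGL2 assms(1)])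
  then have "PGL2_act (inv\<^bsub>PGL2\<^esub> X) (PGL2_act X L) = PGL2_act (inv\<^bsub>PGL2\<^esub> X \<otimes>\<^bsub>PGL2\<^esub> X) L"
    using assms by (simp only: PGL2_act_mult)
  also have "\<dots> = L"
    using assms by (simp only: group.l_inv[OF group_PGL2] PGL2_act_one)
  finally show ?thesis .
qed

text \<open>Three pairwise independent eigenvectors in a plane force a single eigenvalue: the third is a
  combination of the first two with both coefficients nonzero, and comparing coefficients shows
  that all three eigenvalues agree.\<close>

lemma PGL2_three_fixed_lines:
  assumes X: "X \<in> carrier PGL2"
    and L: "L1 \<in> proj_line" "L2 \<in> proj_line" "L3 \<in> proj_line"
    and ne: "L1 \<noteq> L2" "L1 \<noteq> L3" "L2 \<noteq> L3"
    and fixed: "PGL2_act X L1 = L1" "PGL2_act X L2 = L2" "PGL2_act X L3 = L3"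
  shows "X = \<one>\<^bsub>PGL2\<^esub>"
proof -
  obtain A where A: "invertible A" "X = pgl_class A" using X by (rule PGL2_E)
  obtain v1 where v1: "v1 \<noteq> 0" "L1 = line v1" using L(1) by (rule proj_lineE)
  obtain v2 where v2: "v2 \<noteq> 0" "L2 = line v2" using L(2) by (rule proj_lineE)
  obtain v3 where v3: "v3 \<noteq> 0" "L3 = line v3" using L(3) by (rule proj_lineE)
  note v = v1 v2 v3
  have eig: "\<exists>c. c \<noteq> 0 \<and> A *v w = c *s w" if "w \<noteq> 0" "PGL2_act X (line w) = line w" for w
  proof -
    have "A *v w \<noteq> 0" using that invertible_mult_eq_0[OF A(1)] by blast
    moreover have "line (A *v w) = line w" using that(2) by (simp add: A(2) PGL2_act_class)
    ultimately show ?thesis using that(1) by (simp add: line_eq_iff)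
  qed
  obtain c1 c2 c3 where c: "c1 \<noteq> 0" "A *v v1 = c1 *s v1" "A *v v2 = c2 *s v2" "A *v v3 = c3 *s v3"
    using eig[of v1] eig[of v2] eig[of v3] v fixed by metis
  obtain a b where ab: "v3 = a *s v1 + b *s v2"
    using line_combination[OF v1(1) v2(1)] ne(1) v by blast
  have "a \<noteq> 0" "b \<noteq> 0"
    using ab v ne line_eq_iff[of v3 v2] line_eq_iff[of v3 v1] by auto
  have "c3 *s v3 = a *s (c1 *s v1) + b *s (c2 *s v2)"
    unfolding c(4)[symmetric] c(2)[symmetric] c(3)[symmetric] unfolding ab
    by (simp add: matrix_vector_right_distrib vector_scalar_commute)
  then have eq: "(a * (c3 - c1)) *s v1 = (b * (c2 - c3)) *s v2"
    unfolding ab by (simp add: vec_eq_iff algebra_simps)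
  have zero: "x = 0 \<and> y = 0" if "x *s v1 = y *s v2" for x y
  proof (rule ccontr)
    assume "\<not> ?thesis"
    with that v have "x \<noteq> 0" "y \<noteq> 0" by (auto simp: vec.scale_eq_0_iff)
    moreover have "v1 = (y / x) *s v2"
      using that \<open>x \<noteq> 0\<close> by (metis vec.scale_scale vec.scale_one divide_inverse_commute left_inverse)
    ultimately show False using v ne line_eq_iff[of v1 v2] by (metis divide_eq_0_iff)
  qed
  have cc: "c2 = c1" using zero[OF eq] \<open>a \<noteq> 0\<close> \<open>b \<noteq> 0\<close> by auto
  have "A *v x = mat c1 *v x" for x
  proof -
    obtain s t where x: "x = s *s v1 + t *s v2"
      using line_combination[OF v1(1) v2(1)] ne(1) v by blast
    have "A *v x = c1 *s x"
      unfolding x by (simp add: matrix_vector_right_distrib vector_scalar_commute c cc vec.scale_right_distrib mult.commute)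
    also have "\<dots> = mat c1 *v x" by (simp add: mat_vec)
    finally show ?thesis .
  qed
  then have "A = mat c1" by (simp add: matrix_eq)
  then show ?thesis using c(1) by (simp add: A(2) pgl_class_mat)
qed

text \<open>Points where \<open>X\<close> and \<open>Y\<close> agree are fixed points of \<open>Y\<^sup>-\<^sup>1X\<close>.\<close>

lemma PGL2_agree_le_two:
  fixes X Y :: "('a::{field,finite} ^ 2 ^ 2) set"
  assumes XY: "X \<in> carrier PGL2" "Y \<in> carrier PGL2" and ne: "X \<noteq> Y"
  shows "card {L \<in> proj_line. PGL2_act X L = PGL2_act Y L} \<le> 2"
proof (rule ccontr)
  interpret group "PGL2 :: ('a ^ 2 ^ 2) set monoid" by (rule group_PGL2)
  assume "\<not> ?thesis"
  then have "3 \<le> card {L \<in> proj_line. PGL2_act X L = PGL2_act Y L}" by simp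
  then obtain T where T: "T \<subseteq> {L \<in> proj_line. PGL2_act X L = PGL2_act Y L}" "card T = 3"
    by (rule obtain_subset_with_card_n) blast
  from T(2) obtain L1 L2 L3 where L: "T = {L1, L2, L3}" "L1 \<noteq> L2" "L2 \<noteq> L3" "L1 \<noteq> L3"
    by (subst (asm) card_3_iff) blast
  have fixed: "L \<in> proj_line \<and> PGL2_act (inv\<^bsub>PGL2\<^esub> Y \<otimes>\<^bsub>PGL2\<^esub> X) L = L" if "L \<in> T" for L
  proof -
    have "L \<in> proj_line" "PGL2_act X L = PGL2_act Y L" using that T(1) by blast+
    with XY show ?thesis by (simp add: PGL2_act_mult PGL2_act_inv)
  qed
  have fixed: "L \<in> proj_line" "PGL2_act (inv\<^bsub>PGL2\<^esub> Y \<otimes>\<^bsub>PGL2\<^esub> X) L = L"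
    if "L = L1 \<or> L = L2 \<or> L = L3" for L
    using fixed[of L] that unfolding L(1) by blast+
  have "inv\<^bsub>PGL2\<^esub> Y \<otimes>\<^bsub>PGL2\<^esub> X \<in> carrier PGL2" using XY by simp
  then have one: "inv\<^bsub>PGL2\<^esub> Y \<otimes>\<^bsub>PGL2\<^esub> X = \<one>\<^bsub>PGL2\<^esub>"
    by (rule PGL2_three_fixed_lines[of _ L1 L2 L3]) (use L(2-4) fixed in simp_all)
  have "X = Y \<otimes>\<^bsub>PGL2\<^esub> (inv\<^bsub>PGL2\<^esub> Y \<otimes>\<^bsub>PGL2\<^esub> X)"
    using XY by (simp flip: m_assoc)
  also have "\<dots> = Y" using XY unfolding one by simp
  finally show False using ne by simp
qed

section \<open>Singer groups and the pencil of a generator\<close>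

lemma pencil_proportional:
  fixes A :: "'a::field ^ 2 ^ 2"
  assumes "(vector [a, b] :: 'a ^ 2) = c *s vector [a', b']"
  shows "mat a + mat b ** A = mat c ** (mat a' + mat b' ** A)"
proof -
  from assms have "a = c * a'" "b = c * b'" by (auto simp: vec_eq_iff forall_2)
  then show ?thesis
    by (simp add: matrix_add_ldistrib matrix_mul_assoc mat_mult_mat)
qed

lemma not_invertible_0: "\<not> invertible (0 :: 'a::field ^ 2 ^ 2)"
  by (auto simp: invertible_def vec_eq_iff forall_2 mat_def)

lemma pencil_const: "mat a + mat 0 ** A = (mat a :: 'a::field ^ 2 ^ 2)"
  by (simp add: vec_eq_iff forall_2 mat_def matrix_matrix_mult_def sum_2)

lemma pencil_0: "mat 0 + mat 0 ** A = (0 :: 'a::field ^ 2 ^ 2)"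
  unfolding pencil_const by (simp add: vec_eq_iff forall_2 mat_def)

text \<open>A Singer group is given here by a generator, characterised by its order \<open>q + 1\<close>. The regular
  action on the projective line is derived from the order, in \<open>singer_exp_bij\<close>.\<close>

locale singer_generator =
  fixes R :: "('a::{field,finite} ^ 2 ^ 2) set" and n :: nat
  assumes R_carrier [simp]: "R \<in> carrier PGL2"
    and ord_R: "group.ord PGL2 R = n"
    and n_eq: "n = CARD('a) + 1"
begin

interpretation PGL2: group "PGL2 :: ('a ^ 2 ^ 2) set monoid" by (rule group_PGL2)

lemma n_gt_1: "n > 1"
  by (simp add: n_eq)

lemma R_pow_eq_iff: "R [^]\<^bsub>PGL2\<^esub> i = R [^]\<^bsub>PGL2\<^esub> j \<longleftrightarrow> i mod int n = j mod int n" for i j :: int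
  by (metis PGL2.int_pow_eq R_carrier mod_eq_dvd_iff ord_R)

text \<open>A counting argument replaces the usual identification of the pencil with a quadratic extension
  field. The \<open>q + 1\<close> distinct powers of \<open>R\<close> yield pairwise nonproportional elements of the pencil,
  and the coefficient vectors \<open>(a, b)\<close> of the pencil fall into at most \<open>q + 1\<close> lines. Hence
  the powers exhaust the nonzero elements of the pencil up to scalars. In particular all nonzero
  elements are invertible, so \<open>A\<close> has no eigenvector.\<close>

lemma pencil_is_power:
  assumes A: "invertible A" "R = pgl_class A" and ab: "\<not> (a = 0 \<and> b = 0)"
  shows "invertible (mat a + mat b ** A) \<and>
         (\<exists>k::nat. pgl_class (mat a + mat b ** A) = R [^]\<^bsub>PGL2\<^esub> k)"
proof -
  have "\<forall>k::nat. \<exists>a b. invertible (mat a + mat b ** A) \<and>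
      R [^]\<^bsub>PGL2\<^esub> k = pgl_class (mat a + mat b ** A)"
    using pgl_class_pow[OF A(1)] A(2) by metis
  then obtain f g where fg: "\<And>k::nat. invertible (mat (f k) + mat (g k) ** A)"
      "\<And>k. R [^]\<^bsub>PGL2\<^esub> k = pgl_class (mat (f k) + mat (g k) ** A)"
    by metis
  define V where "V k = (vector [f k, g k] :: 'a ^ 2)" for k
  have V0: "V k \<noteq> 0" for k
    using fg(1)[of k] not_invertible_0 pencil_0[of A] by (auto simp: V_def vec_eq_iff forall_2)
  have "inj_on (\<lambda>k. line (V k)) {..<n}"
  proof (rule inj_onI)
    fix i j assume ij: "i \<in> {..<n}" "j \<in> {..<n}" "line (V i) = line (V j)"
    then obtain c where "c \<noteq> 0" "V i = c *s V j" using V0 by (auto simp: line_eq_iff)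
    then have "R [^]\<^bsub>PGL2\<^esub> i = R [^]\<^bsub>PGL2\<^esub> j"
      using pencil_proportional[of "f i" "g i" c "f j" "g j" A]
      by (auto simp: fg(2) V_def pgl_class_eq_iff)
    then have "int i mod int n = int j mod int n"
      using R_pow_eq_iff[of "int i" "int j"] by (simp add: int_pow_int)
    with ij show "i = j" by simp
  qed
  then have "card ((\<lambda>k. line (V k)) ` {..<n}) = n" by (simp add: card_image)
  moreover have "(\<lambda>k. line (V k)) ` {..<n} \<subseteq> proj_line" using V0 by (auto intro: line_in_proj_line)
  ultimately have onto: "(\<lambda>k. line (V k)) ` {..<n} = proj_line"
    using card_proj_line_le[where 'a='a] by (intro card_seteq finite_proj_line) (simp_all add: n_eq)
  have ab0: "(vector [a, b] :: 'a ^ 2) \<noteq> 0" using ab by (auto simp: vec_eq_iff forall_2)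
  then have "line (vector [a, b] :: 'a ^ 2) \<in> (\<lambda>k. line (V k)) ` {..<n}"
    unfolding onto by (rule line_in_proj_line)
  then obtain k where "line (vector [a, b] :: 'a ^ 2) = line (V k)" by blast
  then obtain c where c: "c \<noteq> 0" "vector [a, b] = c *s V k" using V0 ab0 by (auto simp: line_eq_iff)
  then have eq: "mat a + mat b ** A = mat c ** (mat (f k) + mat (g k) ** A)"
    unfolding V_def by (intro pencil_proportional)
  then have "invertible (mat a + mat b ** A)"
    using fg(1) c(1) by (simp add: invertible_mult invertible_mat)
  moreover have "pgl_class (mat a + mat b ** A) = R [^]\<^bsub>PGL2\<^esub> k"
    using eq c(1) by (auto simp: fg(2) pgl_class_eq_iff)
  ultimately show ?thesis by blast
qed

lemma R_int_pow_nat: "\<exists>k::nat. R [^]\<^bsub>PGL2\<^esub> i = R [^]\<^bsub>PGL2\<^esub> k" for i :: int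
  by (rule exI[of _ "nat (i mod int n)"]) (use n_gt_1 in \<open>simp add: R_pow_eq_iff flip: int_pow_int\<close>)

lemma R_pow_pencilE:
  assumes A: "invertible A" "R = pgl_class A"
  obtains a b where "invertible (mat a + mat b ** A)"
    "R [^]\<^bsub>PGL2\<^esub> (i::int) = pgl_class (mat a + mat b ** A)"
  using pgl_class_pow[OF A(1)] R_int_pow_nat[of i] A(2) by metis

text \<open>An element \<open>a + b A\<close> with eigenvalue \<open>c\<close> gives the singular element \<open>(a - c) + b A\<close> of the
  pencil, which must then be zero; so \<open>a + b A\<close> is the scalar \<open>c\<close>.\<close>

lemma R_pow_fixes:
  assumes L: "L \<in> proj_line" and fixed: "PGL2_act (R [^]\<^bsub>PGL2\<^esub> (i::int)) L = L"
  shows "R [^]\<^bsub>PGL2\<^esub> i = \<one>\<^bsub>PGL2\<^esub>"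
proof -
  obtain A where A: "invertible A" "R = pgl_class A" using R_carrier by (rule PGL2_E)
  obtain a b where B: "invertible (mat a + mat b ** A)"
    "R [^]\<^bsub>PGL2\<^esub> i = pgl_class (mat a + mat b ** A)"
    using A by (rule R_pow_pencilE)
  obtain v where v: "v \<noteq> 0" "L = line v" using L by (rule proj_lineE)
  have "(mat a + mat b ** A) *v v \<noteq> 0" using invertible_mult_eq_0[OF B(1)] v(1) by blast
  moreover have "line ((mat a + mat b ** A) *v v) = line v"
    using fixed by (simp add: v(2) B(2) PGL2_act_class)
  ultimately obtain c where c: "c \<noteq> 0" "(mat a + mat b ** A) *v v = c *s v"
    using v(1) by (auto simp: line_eq_iff)
  have "(mat (a - c) + mat b ** A) *v v = 0"
    using c(2) by (simp add: mat_vec matrix_vector_mult_add_rdistrib vec.scale_left_diff_distrib diff_add_eq)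
  then have "\<not> invertible (mat (a - c) + mat b ** A)" using invertible_mult_eq_0 v(1) by blast
  then have "a = c" "b = 0" using pencil_is_power[OF A, of "a - c" b] by auto
  then show ?thesis using c(1) by (simp add: B(2) pencil_const pgl_class_mat)
qed

lemma act_R_exp:
  assumes "P0 \<in> proj_line"
  shows "PGL2_act (R [^]\<^bsub>PGL2\<^esub> u) (singer_exp R P0 x) = singer_exp R P0 ((x + u) mod int n)"
proof -
  have "R [^]\<^bsub>PGL2\<^esub> ((x + u) mod int n) = R [^]\<^bsub>PGL2\<^esub> u \<otimes>\<^bsub>PGL2\<^esub> R [^]\<^bsub>PGL2\<^esub> x"
    by (metis PGL2.int_pow_mult R_carrier R_pow_eq_iff add.commute mod_mod_trivial)
  with assms show ?thesis by (simp add: singer_exp_def PGL2_act_mult)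
qed

text \<open>The action of the Singer group is free, and its orbits have as many elements as the projective
  line can have at most; so it is regular.\<close>

lemma singer_exp_bij:
  assumes P0: "P0 \<in> proj_line"
  shows "bij_betw (singer_exp R P0) {0..int n - 1} proj_line"
proof -
  have inj: "inj_on (singer_exp R P0) {0..int n - 1}"
  proof (rule inj_onI)
    fix i j assume ij: "i \<in> {0..int n - 1}" "j \<in> {0..int n - 1}" "singer_exp R P0 i = singer_exp R P0 j"
    have L: "singer_exp R P0 j \<in> proj_line" using P0 by (simp add: singer_exp_def PGL2_act_closed)
    have "PGL2_act (R [^]\<^bsub>PGL2\<^esub> (i - j)) (singer_exp R P0 j) = singer_exp R P0 i"
      using act_R_exp[OF P0, of "i - j" j] ij(1) by simp
    with R_pow_fixes[OF L, of "i - j"] have "R [^]\<^bsub>PGL2\<^esub> (i - j) = R [^]\<^bsub>PGL2\<^esub> (0::int)"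
      by (simp add: ij(3))
    then have "i mod int n = j mod int n"
      by (simp only: R_pow_eq_iff) (simp add: mod_eq_dvd_iff mod_eq_0_iff_dvd)
    with ij show "i = j" by simp
  qed
  have sub: "singer_exp R P0 ` {0..int n - 1} \<subseteq> proj_line"
    using P0 by (auto simp: singer_exp_def PGL2_act_closed)
  have "card (singer_exp R P0 ` {0..int n - 1}) = n"
    by (simp add: card_image[OF inj])
  then have "singer_exp R P0 ` {0..int n - 1} = proj_line"
    using card_proj_line_le[where 'a='a] by (intro card_seteq finite_proj_line sub) (simp add: n_eq)
  with inj show ?thesis by (simp add: bij_betw_def)
qed

text \<open>If conjugation by \<open>M\<close> carries a single nontrivial element \<open>a + b A\<close> of the Singer group to another
  element of the group, then \<open>b\<close> is nonzero and \<open>A\<close> is a linear combination of \<open>1\<close> and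
  \<open>a + b A\<close>. So the conjugate of \<open>A\<close> lies in the pencil of \<open>A\<close>, and hence its class in the Singer
  group.\<close>

lemma intertwiner_normalizes:
  assumes M: "M \<in> carrier PGL2" and i: "R [^]\<^bsub>PGL2\<^esub> (i::int) \<noteq> \<one>\<^bsub>PGL2\<^esub>"
    and eq: "M \<otimes>\<^bsub>PGL2\<^esub> R [^]\<^bsub>PGL2\<^esub> i = R [^]\<^bsub>PGL2\<^esub> (j::int) \<otimes>\<^bsub>PGL2\<^esub> M"
  obtains k :: nat where "M \<otimes>\<^bsub>PGL2\<^esub> R = R [^]\<^bsub>PGL2\<^esub> k \<otimes>\<^bsub>PGL2\<^esub> M"
proof -
  obtain A where A: "invertible A" "R = pgl_class A" using R_carrier by (rule PGL2_E)
  obtain B where B: "invertible B" "M = pgl_class B" using M by (rule PGL2_E)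
  obtain a b where ab: "invertible (mat a + mat b ** A)"
    "R [^]\<^bsub>PGL2\<^esub> i = pgl_class (mat a + mat b ** A)"
    using A by (rule R_pow_pencilE)
  obtain a' b' where ab': "invertible (mat a' + mat b' ** A)"
    "R [^]\<^bsub>PGL2\<^esub> j = pgl_class (mat a' + mat b' ** A)"
    using A by (rule R_pow_pencilE)
  have "b \<noteq> 0"
  proof
    assume b: "b = 0"
    moreover have "a \<noteq> 0" using ab(1) b not_invertible_0 pencil_0[of A] by auto
    ultimately show False using i by (simp add: ab(2) pencil_const pgl_class_mat)
  qed
  have "pgl_class (B ** (mat a + mat b ** A)) = pgl_class ((mat a' + mat b' ** A) ** B)"
    using eq ab ab' B by (simp add: pgl_class_mult)
  then obtain c where c: "B ** (mat a + mat b ** A) = mat c ** ((mat a' + mat b' ** A) ** B)"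
    by (auto simp: pgl_class_eq_iff)
  \<comment> \<open>The coefficients for which \<open>B A B\<^sup>-\<^sup>1 = p + q A\<close>, from solving the previous equation for
    \<open>B A\<close>.\<close>
  define p where "p = (c * a' - a) / b"
  define q where "q = c * b' / b"
  have "B ** (mat a + mat b ** A) = mat a ** B + mat b ** (B ** A)"
    by (simp add: matrix_add_ldistrib matrix_mul_assoc mat_commute)
  moreover have "mat c ** ((mat a' + mat b' ** A) ** B) = mat (c * a') ** B + mat (c * b') ** (A ** B)"
    by (simp add: matrix_add_ldistrib matrix_add_rdistrib matrix_mul_assoc mat_mult_mat)
  ultimately have "mat b ** (B ** A) = mat (c * a' - a) ** B + mat (c * b') ** (A ** B)"
    using c by (simp add: vec_eq_iff forall_2 mat_def matrix_matrix_mult_def sum_2 algebra_simps)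
  then have "mat (1 / b) ** (mat b ** (B ** A)) = mat (1 / b) ** (mat (c * a' - a) ** B + mat (c * b') ** (A ** B))"
    by simp
  then have BA: "B ** A = (mat p + mat q ** A) ** B"
    using \<open>b \<noteq> 0\<close> by (simp add: matrix_add_ldistrib matrix_add_rdistrib matrix_mul_assoc mat_mult_mat p_def q_def)
  have "\<not> (p = 0 \<and> q = 0)"
  proof
    assume "p = 0 \<and> q = 0"
    then have "B ** A = 0" using BA pencil_0[of A] by simp
    then show False using invertible_mult[OF B(1) A(1)] by (simp add: not_invertible_0)
  qed
  from pencil_is_power[OF A this] obtain k :: nat where k: "invertible (mat p + mat q ** A)"
    "pgl_class (mat p + mat q ** A) = R [^]\<^bsub>PGL2\<^esub> k" by blast
  have "M \<otimes>\<^bsub>PGL2\<^esub> R = R [^]\<^bsub>PGL2\<^esub> k \<otimes>\<^bsub>PGL2\<^esub> M"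
    unfolding k(2)[symmetric] using A B k(1) by (simp add: pgl_class_mult BA)
  then show ?thesis by (rule that)
qed

text \<open>Conjugation by a normalizing \<open>M\<close> must fix the only involution of the cyclic group. In terms of
  exponents, \<open>k (n / 2)\<close> is \<open>0\<close> or \<open>n / 2\<close> modulo \<open>n\<close> according to the parity of \<open>k\<close>, and the
  former is impossible because the conjugate of an involution is not \<open>1\<close>.\<close>

lemma normalizer_commutes_involution:
  assumes M: "M \<in> carrier PGL2" and eq: "M \<otimes>\<^bsub>PGL2\<^esub> R = R [^]\<^bsub>PGL2\<^esub> (k::nat) \<otimes>\<^bsub>PGL2\<^esub> M"
    and n: "even n"
  shows "M \<otimes>\<^bsub>PGL2\<^esub> R [^]\<^bsub>PGL2\<^esub> (n div 2) = R [^]\<^bsub>PGL2\<^esub> (n div 2) \<otimes>\<^bsub>PGL2\<^esub> M"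
proof -
  have pow: "M \<otimes>\<^bsub>PGL2\<^esub> R [^]\<^bsub>PGL2\<^esub> i = R [^]\<^bsub>PGL2\<^esub> (k * i) \<otimes>\<^bsub>PGL2\<^esub> M" for i :: nat
  proof (induction i)
    case (Suc i)
    have "M \<otimes>\<^bsub>PGL2\<^esub> R [^]\<^bsub>PGL2\<^esub> Suc i = (M \<otimes>\<^bsub>PGL2\<^esub> R [^]\<^bsub>PGL2\<^esub> i) \<otimes>\<^bsub>PGL2\<^esub> R"
      using M by (simp add: PGL2.m_assoc)
    also have "\<dots> = R [^]\<^bsub>PGL2\<^esub> (k * i) \<otimes>\<^bsub>PGL2\<^esub> (M \<otimes>\<^bsub>PGL2\<^esub> R)"
      using M by (simp add: Suc PGL2.m_assoc)
    also have "\<dots> = (R [^]\<^bsub>PGL2\<^esub> (k * i) \<otimes>\<^bsub>PGL2\<^esub> R [^]\<^bsub>PGL2\<^esub> k) \<otimes>\<^bsub>PGL2\<^esub> M"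
      using M by (simp add: eq PGL2.m_assoc)
    also have "R [^]\<^bsub>PGL2\<^esub> (k * i) \<otimes>\<^bsub>PGL2\<^esub> R [^]\<^bsub>PGL2\<^esub> k = R [^]\<^bsub>PGL2\<^esub> (k * Suc i)"
      by (simp add: PGL2.nat_pow_mult add.commute)
    finally show ?case .
  qed (use M in simp)
  have J: "R [^]\<^bsub>PGL2\<^esub> (n div 2) \<noteq> \<one>\<^bsub>PGL2\<^esub>"
  proof
    assume "R [^]\<^bsub>PGL2\<^esub> (n div 2) = \<one>\<^bsub>PGL2\<^esub>"
    then have "n dvd n div 2" by (simp add: PGL2.pow_eq_id ord_R)
    moreover have "0 < n div 2" "n div 2 < n" using n n_gt_1 by (auto elim!: evenE)
    ultimately show False by (auto dest: dvd_imp_le)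
  qed
  have Rn: "R [^]\<^bsub>PGL2\<^esub> (n * m) = \<one>\<^bsub>PGL2\<^esub>" for m
    by (simp add: PGL2.pow_eq_id ord_R)
  show ?thesis
  proof (cases "even k")
    case True
    then obtain m where "k = 2 * m" by blast
    then have "k * (n div 2) = n * m" using n by auto
    then have "M \<otimes>\<^bsub>PGL2\<^esub> R [^]\<^bsub>PGL2\<^esub> (n div 2) = M" using pow[of "n div 2"] Rn[of m] M by simp
    then have "R [^]\<^bsub>PGL2\<^esub> (n div 2) = \<one>\<^bsub>PGL2\<^esub>" using M
      by (metis PGL2.l_cancel_one PGL2.nat_pow_closed R_carrier)
    with J show ?thesis by contradiction
  next
    case False
    then obtain m where "k = 2 * m + 1" by (rule oddE)
    then have "k * (n div 2) = n * m + n div 2" using n by auto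
    then have "R [^]\<^bsub>PGL2\<^esub> (k * (n div 2)) = R [^]\<^bsub>PGL2\<^esub> (n div 2)"
      using Rn[of m] by (simp flip: PGL2.nat_pow_mult)
    then show ?thesis using pow[of "n div 2"] by simp
  qed
qed

section \<open>The permutation of exponents induced by a projectivity\<close>

context
  fixes P0 :: "('a ^ 2) set"
  assumes P0: "P0 \<in> proj_line"
begin

lemma
  assumes "M \<in> carrier PGL2" "x \<in> {0..int n - 1}"
  shows singer_perm_mem: "singer_perm R P0 M x \<in> {0..int n - 1}"
    and singer_exp_singer_perm: "singer_exp R P0 (singer_perm R P0 M x) = PGL2_act M (singer_exp R P0 x)"
proof -
  note bij = singer_exp_bij[OF P0]
  have Z: "carrier (Z_mod (CARD('a) + 1)) = {0..int n - 1}" by (simp add: residue_ring_def n_eq)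
  have L: "PGL2_act M (singer_exp R P0 x) \<in> proj_line"
    using assms P0 by (simp add: singer_exp_def PGL2_act_closed)
  show "singer_perm R P0 M x \<in> {0..int n - 1}"
    using bij_betw_apply[OF bij_betw_inv_into[OF bij] L]
    unfolding singer_perm_def singer_log_def o_apply Z .
  show "singer_exp R P0 (singer_perm R P0 M x) = PGL2_act M (singer_exp R P0 x)"
    using bij_betw_inv_into_right[OF bij L]
    unfolding singer_perm_def singer_log_def o_apply Z .
qed

lemma singer_perm_inverse:
  assumes "M \<in> carrier PGL2" "x \<in> {0..int n - 1}"
  shows "singer_perm R P0 (inv\<^bsub>PGL2\<^esub> M) (singer_perm R P0 M x) = x"
proof (rule inj_onD[OF bij_betw_imp_inj_on[OF singer_exp_bij[OF P0]]])
  have "singer_exp R P0 x \<in> proj_line" using P0 by (simp add: singer_exp_def PGL2_act_closed)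
  with assms show "singer_exp R P0 (singer_perm R P0 (inv\<^bsub>PGL2\<^esub> M) (singer_perm R P0 M x)) = singer_exp R P0 x"
    by (simp only: singer_perm_mem singer_exp_singer_perm PGL2.inv_closed PGL2_act_inv)
qed (use assms singer_perm_mem PGL2.inv_closed in auto)

lemma singer_perm_inverse':
  assumes "M \<in> carrier PGL2" "x \<in> {0..int n - 1}"
  shows "singer_perm R P0 M (singer_perm R P0 (inv\<^bsub>PGL2\<^esub> M) x) = x"
  using singer_perm_inverse[of "inv\<^bsub>PGL2\<^esub> M" x] assms by simp

lemma singer_perm_bij:
  assumes "M \<in> carrier PGL2"
  shows "bij_betw (singer_perm R P0 M) {0..int n - 1} {0..int n - 1}"
  by (rule bij_betw_byWitness[where f' = "singer_perm R P0 (inv\<^bsub>PGL2\<^esub> M)"])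
     (use assms singer_perm_inverse singer_perm_inverse' singer_perm_mem PGL2.inv_closed in auto)

text \<open>Through the bijection with the projective line, \<open>F (x + u) = F x + v\<close> reads
  \<open>M R\<^sup>u P = R\<^sup>v M P\<close> for the point \<open>P = R\<^sup>x P0\<close>. The fibre is thus a set of
  points where two elements of \<open>PGL2\<close> agree.\<close>

lemma card_differential_fibre_le:
  assumes M: "M \<in> carrier PGL2"
    and ne: "M \<otimes>\<^bsub>PGL2\<^esub> R [^]\<^bsub>PGL2\<^esub> u \<noteq> R [^]\<^bsub>PGL2\<^esub> v \<otimes>\<^bsub>PGL2\<^esub> M"
  shows "card {x \<in> {0..int n - 1}.
    (singer_perm R P0 M ((x + u) mod int n) - singer_perm R P0 M x) mod int n = v} \<le> 2"
    (is "card ?S \<le> 2")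
proof -
  let ?X = "M \<otimes>\<^bsub>PGL2\<^esub> R [^]\<^bsub>PGL2\<^esub> u" and ?Y = "R [^]\<^bsub>PGL2\<^esub> v \<otimes>\<^bsub>PGL2\<^esub> M"
  let ?F = "singer_perm R P0 M" and ?e = "singer_exp R P0"
  have "?e ` ?S \<subseteq> {L \<in> proj_line. PGL2_act ?X L = PGL2_act ?Y L}"
  proof (rule image_subsetI)
    fix x assume "x \<in> ?S"
    then have x: "x \<in> {0..int n - 1}" "v = (?F ((x + u) mod int n) - ?F x) mod int n" by auto
    have L: "?e x \<in> proj_line" using P0 by (simp add: singer_exp_def PGL2_act_closed)
    have xu: "(x + u) mod int n \<in> {0..int n - 1}"
      using n_gt_1 by simp
    have Fu: "?F ((x + u) mod int n) = (?F x + v) mod int n"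
      using singer_perm_mem[OF M xu] by (simp add: x(2) mod_simps)
    have "PGL2_act ?X (?e x) = PGL2_act M (?e ((x + u) mod int n))"
      using M L by (simp only: PGL2_act_mult PGL2.int_pow_closed R_carrier act_R_exp[OF P0])
    also have "\<dots> = ?e ((?F x + v) mod int n)"
      by (simp only: singer_exp_singer_perm[OF M xu, symmetric] Fu)
    also have "\<dots> = PGL2_act (R [^]\<^bsub>PGL2\<^esub> v) (PGL2_act M (?e x))"
      by (simp only: act_R_exp[OF P0, symmetric] singer_exp_singer_perm[OF M x(1)])
    also have "\<dots> = PGL2_act ?Y (?e x)" using M L by (simp add: PGL2_act_mult)
    finally show "?e x \<in> {L \<in> proj_line. PGL2_act ?X L = PGL2_act ?Y L}" using L by simp
  qed
  then have "card (?e ` ?S) \<le> card {L \<in> proj_line. PGL2_act ?X L = PGL2_act ?Y L}"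
    by (intro card_mono) (simp_all add: finite_proj_line)
  also have "\<dots> \<le> 2" using M ne by (intro PGL2_agree_le_two) auto
  also have "card (?e ` ?S) = card ?S"
    by (intro card_image inj_on_subset[OF bij_betw_imp_inj_on[OF singer_exp_bij[OF P0]]]) auto
  finally show ?thesis .
qed

end

end

section \<open>The APN property\<close>

theorem theorem1:
  fixes C :: "('a::{field,finite} ^ 2 ^ 2) set set"
    and R J M :: "('a ^ 2 ^ 2) set"
    and P0 :: "('a ^ 2) set"
    and n :: nat
  defines "n \<equiv> CARD('a) + 1"
  defines "J \<equiv> R [^]\<^bsub>PGL2\<^esub> (n div 2)"
  assumes "odd CARD('a)"
    and "singer_group C"
    and "R \<in> C" and "C = generate PGL2 {R}"
    and "P0 \<in> proj_line"
    and "M \<in> carrier PGL2"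
    and "M \<otimes>\<^bsub>PGL2\<^esub> J \<noteq> J \<otimes>\<^bsub>PGL2\<^esub> M"
  shows "bij_betw (singer_perm R P0 M) (carrier (Z_mod n)) (carrier (Z_mod n)) \<and>
         APN n (singer_perm R P0 M) \<and>
         (\<exists>N \<in> carrier PGL2. N \<otimes>\<^bsub>PGL2\<^esub> J \<noteq> J \<otimes>\<^bsub>PGL2\<^esub> N \<and>
           (\<forall>i \<in> carrier (Z_mod n).
              inv_into (carrier (Z_mod n)) (singer_perm R P0 M) i = singer_perm R P0 N i))"
proof -
  interpret PGL2: group "PGL2 :: ('a ^ 2 ^ 2) set monoid" by (rule group_PGL2)
  note P0 = \<open>P0 \<in> proj_line\<close> and M = \<open>M \<in> carrier PGL2\<close>
  have sub: "subgroup C PGL2" and card_C: "card C = CARD('a) + 1"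
    using \<open>singer_group C\<close> by (auto simp: singer_group_def order_def)
  have R: "R \<in> carrier PGL2" using sub \<open>R \<in> C\<close> by (rule subgroup.mem_carrier)
  interpret singer_generator R n
    by unfold_locales (use R card_C \<open>C = generate PGL2 {R}\<close> PGL2.generate_pow_card[OF R] in \<open>auto simp: n_def\<close>)
  have Z: "carrier (Z_mod n) = {0..int n - 1}" by (simp add: residue_ring_def)
  have bij: "bij_betw (singer_perm R P0 M) {0..int n - 1} {0..int n - 1}"
    by (rule singer_perm_bij[OF P0 M])
  have J: "J \<in> carrier PGL2" by (simp add: J_def R)
  \<comment> \<open>If a fibre of a derivative were too large, \<open>M\<close> would normalize the Singer group.\<close>
  have "APN n (singer_perm R P0 M)"
  proof (rule APN_Z_modI[OF _ bij])
    show "n > 1" by (rule n_gt_1)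
    fix u v assume u: "u \<in> {1..int n - 1}" and v: "v \<in> {0..int n - 1}"
    have "M \<otimes>\<^bsub>PGL2\<^esub> R [^]\<^bsub>PGL2\<^esub> u \<noteq> R [^]\<^bsub>PGL2\<^esub> v \<otimes>\<^bsub>PGL2\<^esub> M"
    proof
      assume eq: "M \<otimes>\<^bsub>PGL2\<^esub> R [^]\<^bsub>PGL2\<^esub> u = R [^]\<^bsub>PGL2\<^esub> v \<otimes>\<^bsub>PGL2\<^esub> M"
      have "R [^]\<^bsub>PGL2\<^esub> u \<noteq> \<one>\<^bsub>PGL2\<^esub>"
        using R_pow_eq_iff[of u 0] u by simp
      then obtain k :: nat where "M \<otimes>\<^bsub>PGL2\<^esub> R = R [^]\<^bsub>PGL2\<^esub> k \<otimes>\<^bsub>PGL2\<^esub> M"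
        using intertwiner_normalizes[OF M _ eq] by blast
      then have "M \<otimes>\<^bsub>PGL2\<^esub> J = J \<otimes>\<^bsub>PGL2\<^esub> M"
        unfolding J_def using \<open>odd CARD('a)\<close> by (intro normalizer_commutes_involution[OF M]) (simp_all add: n_def)
      with \<open>M \<otimes>\<^bsub>PGL2\<^esub> J \<noteq> J \<otimes>\<^bsub>PGL2\<^esub> M\<close> show False by contradiction
    qed
    then show "card {x \<in> {0..int n - 1}.
        (singer_perm R P0 M ((x + u) mod int n) - singer_perm R P0 M x) mod int n = v} \<le> 2"
      by (rule card_differential_fibre_le[OF P0 M])
  qed
  moreover have "inv\<^bsub>PGL2\<^esub> M \<otimes>\<^bsub>PGL2\<^esub> J \<noteq> J \<otimes>\<^bsub>PGL2\<^esub> inv\<^bsub>PGL2\<^esub> M"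
  proof
    assume eq: "inv\<^bsub>PGL2\<^esub> M \<otimes>\<^bsub>PGL2\<^esub> J = J \<otimes>\<^bsub>PGL2\<^esub> inv\<^bsub>PGL2\<^esub> M"
    have "J \<otimes>\<^bsub>PGL2\<^esub> M = M \<otimes>\<^bsub>PGL2\<^esub> (inv\<^bsub>PGL2\<^esub> M \<otimes>\<^bsub>PGL2\<^esub> J) \<otimes>\<^bsub>PGL2\<^esub> M"
      using M J by (simp flip: PGL2.m_assoc)
    also have "\<dots> = M \<otimes>\<^bsub>PGL2\<^esub> J"
      unfolding eq using M J by (simp add: PGL2.m_assoc)
    finally show False using \<open>M \<otimes>\<^bsub>PGL2\<^esub> J \<noteq> J \<otimes>\<^bsub>PGL2\<^esub> M\<close> by simp
  qed
  moreover have "inv_into {0..int n - 1} (singer_perm R P0 M) i = singer_perm R P0 (inv\<^bsub>PGL2\<^esub> M) i"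
    if "i \<in> {0..int n - 1}" for i
    using that M
    by (intro inv_into_f_eq bij_betw_imp_inj_on[OF singer_perm_bij[OF P0]] singer_perm_mem[OF P0]
        singer_perm_inverse'[OF P0] PGL2.inv_closed)
  ultimately show ?thesis using bij M unfolding Z by (blast intro: PGL2.inv_closed)
qed

end
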